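(* Let $n \ge 1$ and $\ell \ge 2$ be integers, and let $x^0=(x^0_1,\dots,x^0_n)\in\mathbb{Z}^n$ satisfy $x^0_1\le\dots\le x^0_n$ and have at least one entry that is a multiple of $\ell$. Let $S=(x^0\to x^1\to\dots\to x^j\to\dots)$ be the GM-sequence starting at $x^0$, and for $i\in[n]$ let $W_i$ be the associated infinite word in the alphabet $\{s,r\}$. If $\mathrm{range}(x^0)\le \ell$, then the following statements hold: (1) For every $i\in[n]$ and $j\ge 0$ we have $x_i^j-x_i^{j+n\ell}=(n-1)\ell$. (2) All infinite words $W_i$, $i\in[n]$, are equivalent and periodic; their common period $P$ is of length $p=n\ell$; the corresponding word $W(P)$ contains $\ell$ symbols $s$ and $(n-1)\ell$ symbols $r$. (3) For every $i\in[n]$, the length of a maximal sequence of successive $r$'s in $W_i$ is a multiple of $\ell$. (4) For every $i\in[n]$, the length of a maximal sequence of successive $s$'s in $W_i$ is at most $\ell$.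
   Context: Notation: $[n]=\{1,\dots,n\}$. Entries of vectors are integers and may be negative. For a vector with $x_1\le\dots\le x_n$, $\mathrm{range}(x)=x_n-x_1$. Pivot: let $x=(x_1,\dots,x_n)$ be an integer vector with $x_1\le \dots\le x_n$ having at least one entry that is a multiple of $\ell$. Choose a minimal entry of $x$ among those that are multiples of $\ell$; if there are several such entries, take the one with the largest index. This index $i\in[n]$ is the pivot of $x$, and $x_i$ is the pivotal entry. GM-move: the GM-move $x\to x'$ keeps the pivotal entry unchanged and reduces each of the remaining $n-1$ entries by $1$. The vector $x'$ again satisfies $x'_1\le\dots\le x'_n$ and has an entry that is a multiple of $\ell$. The GM-sequence starting at $x^0$ is the infinite sequence $x^0\to x^1\to x^2\to\dots$ of successive GM-moves. Words: for $i\in[n]$ and $j\ge 0$, put $l(i,j)=s$ if $i$ is the pivot of $x^j$, and $l(i,j)=r$ otherwise. The word $W_i$ is the infinite word $l(i,0)\,l(i,1)\,l(i,2)\cdots$. The word $W_i$ is called periodic if there is an integer $p>0$ such that $l(i,j)=l(i,j+p)$ for all $j\ge 0$; by default $p$ is assumed to be minimal. Any interval $P$ of $p$ successive symbols is called a period, and $p=|P|$ is its length; $W(P)$ denotes the word formed by the symbols of $P$. Two periodic words $W_i$ and $W_{i'}$ are called equivalent if their periods $P_i$ and $P_{i'}$ can be chosen equal.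
   Formalization: In (2), nℓ is shown to be a period, not always the minimal one (n=3, ℓ=2, x⁰=(0,1,2) has minimal period 3); in (3), r-runs at the very start of W_i are excluded (fails for x⁰=(-1,0), ℓ=2); in (4), only finite s-runs are bounded (for n=1 the word is sss…). *)

theory Defs
  imports Main
begin

text \<open>
  A vector of length \<open>n\<close> is a function of type \<open>nat \<Rightarrow> int\<close>
  of which only the entries with index in \<open>{1..n}\<close> matter.
\<close>

definition vec_range :: "nat \<Rightarrow> (nat \<Rightarrow> int) \<Rightarrow> int" where
  "vec_range n x = x n - x 1"

text \<open>
  Meaningful only if some entry is a multiple of \<open>l\<close>; otherwise the set below is empty.
\<close>

definition pivot :: "nat \<Rightarrow> nat \<Rightarrow> (nat \<Rightarrow> int) \<Rightarrow> nat" where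
  "pivot l n x = Max {i \<in> {1..n}. int l dvd x i \<and>
     (\<forall>k\<in>{1..n}. int l dvd x k \<longrightarrow> x i \<le> x k)}"

definition gm_move :: "nat \<Rightarrow> nat \<Rightarrow> (nat \<Rightarrow> int) \<Rightarrow> (nat \<Rightarrow> int)" where
  "gm_move l n x = (\<lambda>k. if k = pivot l n x then x k else x k - 1)"

definition gm_seq :: "nat \<Rightarrow> nat \<Rightarrow> (nat \<Rightarrow> int) \<Rightarrow> nat \<Rightarrow> (nat \<Rightarrow> int)" where
  "gm_seq l n x0 j = (gm_move l n ^^ j) x0"

text \<open>The letters \<open>s\<close> and \<open>r\<close> are called \<open>Stay\<close> and \<open>Reduce\<close>.\<close>

datatype letter = Stay | Reduce

definition gm_word :: "nat \<Rightarrow> nat \<Rightarrow> (nat \<Rightarrow> int) \<Rightarrow> nat \<Rightarrow> (nat \<Rightarrow> letter)" where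
  "gm_word l n x0 i = (\<lambda>j. if i = pivot l n (gm_seq l n x0 j) then Stay else Reduce)"

text \<open>
  A period need not be minimal: for \<open>n = 3\<close>, \<open>l = 2\<close> and the start \<open>(0, 1, 2)\<close>
  the words have minimal period 3, a proper divisor of \<open>n * l\<close>.
\<close>

definition is_period :: "(nat \<Rightarrow> 'a) \<Rightarrow> nat \<Rightarrow> bool" where
  "is_period w p \<longleftrightarrow> p > 0 \<and> (\<forall>j. w j = w (j + p))"

definition periodic :: "(nat \<Rightarrow> 'a) \<Rightarrow> bool" where
  "periodic w \<longleftrightarrow> (\<exists>p. is_period w p)"

definition min_period :: "(nat \<Rightarrow> 'a) \<Rightarrow> nat" where
  "min_period w = (LEAST p. is_period w p)"

definition segment :: "(nat \<Rightarrow> 'a) \<Rightarrow> nat \<Rightarrow> nat \<Rightarrow> 'a list" where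
  "segment w a p = map w [a..<a + p]"

definition equivalent_words :: "(nat \<Rightarrow> 'a) \<Rightarrow> (nat \<Rightarrow> 'a) \<Rightarrow> bool" where
  "equivalent_words w w' \<longleftrightarrow> periodic w \<and> periodic w' \<and>
     (\<exists>a a'. segment w a (min_period w) = segment w' a' (min_period w'))"

text \<open>
  The block of positions \<open>a, \<dots>, a + m - 1\<close> is a (finite) maximal block of letters \<open>c\<close>.
  If \<open>a = 0\<close>, it is an initial block of the word, and nothing is required on its left:
  such a block may be the truncated end of a block of the two-sided periodic word.
\<close>

definition maximal_run :: "'a \<Rightarrow> (nat \<Rightarrow> 'a) \<Rightarrow> nat \<Rightarrow> nat \<Rightarrow> bool" where
  "maximal_run c w a m \<longleftrightarrow> m > 0 \<and> (\<forall>j\<in>{a..<a + m}. w j = c) \<and>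
     w (a + m) \<noteq> c \<and> (a = 0 \<or> w (a - 1) \<noteq> c)"

end

theory Submission imports Defs begin

text \<open>
  Extend a sorted vector of range at most \<open>l\<close> to all integer indices by
  \<open>x (k + n) = x k + l\<close>. The extension is again monotone, and modulo \<open>n\<close> the pivot is the
  largest extended index \<open>q\<close> of an entry \<open>\<le> 0\<close>. In a frame moving with speed \<open>1\<close> a GM-move
  only advances the pivotal entry, so that exactly one of \<open>l\<close> consecutive moves takes an entry
  across a given residue class. Hence \<open>q\<close> is nondecreasing in time and grows by exactly
  \<open>n - 1\<close> in \<open>l\<close> moves. All claims follow from these two properties, since the letter of
  \<open>W\<^sub>i\<close> is \<open>s\<close> iff \<open>q \<equiv> i\<close> modulo \<open>n\<close>.
\<close>

section \<open>Monotone sequences with \<open>q (j + l) = q j + n - 1\<close>\<close>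

text \<open>Here \<open>q j\<close> stands for a pivot index known modulo \<open>n\<close>, and
  \<open>int n dvd q j - i\<close> for the letter s of word \<open>i\<close> at time
  \<open>j\<close>.\<close>

locale drift =
  fixes n l :: nat and q :: "nat \<Rightarrow> int"
  assumes n_pos: "n > 0" and l_pos: "l > 0"
    and q_mono: "mono q"
    and q_step: "q (j + l) = q j + int n - 1"
begin

lemma q_steps: "q (j + t * l) = q j + int t * (int n - 1)"
proof (induction t)
  case (Suc t)
  have "q (j + Suc t * l) = q ((j + t * l) + l)" by (simp add: add_ac)
  then show ?case using Suc unfolding q_step[of "j + t * l"] by (simp add: distrib_right)
qed simp

text \<open>Modulo \<open>n\<close> the increment \<open>n - 1\<close> is \<open>-1\<close>, so
  waiting \<open>t * l\<close> moves amounts to replacing \<open>i\<close> by \<open>i + t\<close>.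
  This makes the words time shifts of each other; \<open>t = n\<close> gives the period.\<close>

lemma dvd_shift: "int n dvd q (j + t * l) - i \<longleftrightarrow> int n dvd q j - (i + int t)"
proof -
  have "q (j + t * l) - i = (q j - (i + int t)) + int n * int t"
    unfolding q_steps by (simp add: algebra_simps)
  then show ?thesis by (metis dvd_add_left_iff dvd_triv_left)
qed

lemma dvd_periodic: "int n dvd q (j + n * l) - i \<longleftrightarrow> int n dvd q j - i"
proof -
  have "q j - (i + int n) = (q j - i) - int n" by simp
  then show ?thesis using dvd_shift[of j n i] by (simp only: dvd_diff_right_iff[OF dvd_refl] dvd_diff_left_iff dvd_refl)
qed

lemma drift_shift: "drift n l (\<lambda>j. q (j + a))"
proof
  show "mono (\<lambda>j. q (j + a))" using q_mono by (auto simp: mono_def)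
  show "q (j + l + a) = q (j + a) + int n - 1" for j
    using q_step[of "j + a"] by (simp add: add_ac)
qed (use n_pos l_pos in auto)

text \<open>At the times \<open>r, r + l, ..., r + (n - 1) * l\<close> the values of
  \<open>q\<close> meet each residue modulo \<open>n\<close> exactly once, hence one hit for each of
  the \<open>l\<close> choices of \<open>r\<close>.\<close>

lemma count_initial: "(\<Sum>j<n * l. if int n dvd q j - i then 1 else 0) = l"
proof -
  let ?f = "\<lambda>j. if int n dvd q j - i then 1 else 0 :: nat"
  have one: "(\<Sum>t<n. ?f (t * l + r)) = 1" for r
  proof -
    define t0 where "t0 = nat ((q r - i) mod int n)"
    have "int t0 = (q r - i) mod int n" "t0 < n"
      using n_pos by (auto simp: t0_def nat_less_iff)
    have "int n dvd q (t * l + r) - i \<longleftrightarrow> t = t0" if "t < n" for t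
    proof -
      have "int n dvd q (t * l + r) - i \<longleftrightarrow> int n dvd (q r - i) - int t"
        using dvd_shift[of r t i] by (simp add: add_ac diff_diff_eq)
      also have "\<dots> \<longleftrightarrow> (q r - i) mod int n = int t mod int n"
        by (simp add: mod_eq_dvd_iff)
      also have "\<dots> \<longleftrightarrow> t = t0" using that \<open>int t0 = _\<close> by auto
      finally show ?thesis .
    qed
    then have "(\<Sum>t<n. ?f (t * l + r)) = (\<Sum>t<n. if t = t0 then 1 else 0)"
      by (intro sum.cong) auto
    then show ?thesis using \<open>t0 < n\<close> by simp
  qed
  have "(\<Sum>j<n * l. ?f j) = (\<Sum>t<n. \<Sum>j\<in>{t * l..<t * l + l}. ?f j)"
    by (simp only: sum.nat_group)
  also have "\<dots> = (\<Sum>t<n. \<Sum>r<l. ?f (t * l + r))"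
    by (simp add: sum.shift_bounds_nat_ivl[where m = 0, simplified] atLeast0LessThan sum.atLeastLessThan_shift_0)
  also have "\<dots> = (\<Sum>r<l. \<Sum>t<n. ?f (t * l + r))"
    by (rule sum.swap)
  also have "\<dots> = l" by (simp only: one sum_constant card_lessThan mult_1_right of_nat_id)
  finally show ?thesis .
qed

text \<open>If \<open>q\<close> jumps by \<open>d\<close> on leaving the hit at \<open>b\<close>,
  then \<open>1 \<le> d \<le> n - 1\<close>, and \<open>d * l\<close> moves later it equals
  \<open>q b + d * n\<close>. This is the next hit, so the gap is exactly
  \<open>d * l\<close>.\<close>

lemma gap_dvd:
  assumes before: "int n dvd q b - i"
    and gap: "\<And>j. j \<in> {Suc b..<Suc b + m} \<Longrightarrow> \<not> int n dvd q j - i"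
    and after: "int n dvd q (Suc b + m) - i" and "m > 0"
  shows "l dvd m"
proof -
  define a where "a = Suc b"
  define d where "d = q a - q b"
  have "d \<noteq> 0" using gap[of a] before \<open>m > 0\<close> unfolding a_def d_def by auto
  moreover have "d \<ge> 0" using q_mono unfolding d_def a_def by (simp add: monoD)
  ultimately have "d \<ge> 1" by linarith
  have "q a \<le> q (b + l)" using l_pos by (intro monoD[OF q_mono]) (simp add: a_def)
  then have "d \<le> int n - 1" by (simp add: d_def q_step)
  define D where "D = nat d"
  have D: "int D = d" using \<open>d \<ge> 1\<close> by (simp add: D_def)
  have hit: "int n dvd q (a + D * l) - i"
  proof -
    have "q a - (i + int D) = q b - i" by (simp add: D d_def)
    then show ?thesis using before by (simp only: dvd_shift)
  qed
  \<comment> \<open>With \<open>t = k div l\<close>, the value lies strictly between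
    \<open>q b + t * n\<close> and \<open>q b + (t + 1) * n\<close>: the lower bound uses
    \<open>t < D\<close>, the upper one compares with time \<open>b + (t + 1) * l\<close>.\<close>
  have miss: "\<not> int n dvd q (a + k) - i" if "k < D * l" for k
  proof
    assume A: "int n dvd q (a + k) - i"
    define t where "t = k div l"
    have t: "t < D" using that by (simp add: t_def less_mult_imp_div_less)
    have "t * l \<le> k" by (simp add: t_def)
    then have "q (a + t * l) \<le> q (a + k)" using q_mono by (simp add: monoD)
    then have lower: "q b + int t * int n + 1 \<le> q (a + k)"
      using t D unfolding q_steps d_def by (simp add: algebra_simps)
    have "a + k \<le> b + Suc t * l"
      using l_pos dividend_less_times_div[of l k] by (simp add: a_def t_def algebra_simps)
    then have "q (a + k) \<le> q (b + Suc t * l)" using q_mono by (rule monoD[rotated])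
    then have upper: "q (a + k) \<le> q b + int (Suc t) * int n - 1"
      unfolding q_steps by (simp add: algebra_simps)
    have "int n dvd (q (a + k) - i) - (q b - i)" using A before by (rule dvd_diff)
    then have "int n dvd (q (a + k) - q b - int t * int n)"
      by (simp add: dvd_diff)
    moreover have "0 < q (a + k) - q b - int t * int n" using lower by simp
    moreover have "q (a + k) - q b - int t * int n < int n"
      using upper by (simp add: algebra_simps)
    ultimately show False using zdvd_not_zless by blast
  qed
  have "m = D * l"
  proof (rule linorder_cases)
    assume "m < D * l"
    then show ?thesis using miss after by (simp add: a_def)
  next
    assume "D * l < m"
    then show ?thesis using gap[of "a + D * l"] hit by (simp add: a_def)
  qed
  then show ?thesis by simp
qed

text \<open>Hits at both \<open>a\<close> and \<open>a + l\<close> would force \<open>n\<close> to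
  divide \<open>n - 1\<close>, so \<open>n = 1\<close>; but then every time is a hit, against
  \<open>stop\<close>.\<close>

lemma run_le:
  assumes run: "\<And>j. j \<in> {a..<a + m} \<Longrightarrow> int n dvd q j - i"
    and stop: "\<not> int n dvd q (a + m) - i"
  shows "m \<le> l"
proof (rule ccontr)
  assume "\<not> m \<le> l"
  then have "int n dvd q (a + l) - i" "int n dvd q a - i"
    using run[of "a + l"] run[of a] by auto
  then have "int n dvd (q (a + l) - i) - (q a - i)" by (rule dvd_diff)
  then have "int n dvd int n - 1" by (simp add: q_step)
  then have "int n dvd int n - (int n - 1)" by (rule dvd_diff[OF dvd_refl])
  then have "n = 1" by simp
  then show False using stop by simp
qed

end

section \<open>Periodic words\<close>

lemma count_segment: "count_list (segment w a p) c = (\<Sum>j<p. if w (j + a) = c then 1 else 0)"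
proof (induction p)
  case (Suc p)
  then show ?case by (simp add: segment_def add_ac)
qed (simp add: segment_def)

lemma is_period_mult:
  assumes "is_period w p"
  shows "w (j + k * p) = w j"
proof (induction k)
  case (Suc k)
  have "w (j + Suc k * p) = w (j + k * p + p)" by (simp add: add_ac)
  also have "\<dots> = w (j + k * p)" using assms unfolding is_period_def by metis
  finally show ?case using Suc by simp
qed simp

text \<open>A shift by \<open>d\<close> is undone by a further shift that completes a multiple of
  the period, so both words have the same periods and the same minimal one.\<close>

lemma equivalent_words_shift:
  assumes "is_period w p" and shift: "\<And>j. w' j = w (j + d)"
  shows "equivalent_words w w'"
proof -
  have "p > 0" using assms by (simp add: is_period_def)
  have unshift: "w j = w' (j + (d * p - d))" for j
  proof -
    have "w (j + d * p) = w j" by (rule is_period_mult) fact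
    moreover have "d * p - d + d = d * p" using \<open>p > 0\<close> by (intro le_add_diff_inverse2) simp
    ultimately show ?thesis by (simp only: shift add.assoc)
  qed
  have same: "is_period w r \<longleftrightarrow> is_period w' r" for r
  proof
    assume "is_period w r"
    then show "is_period w' r" unfolding is_period_def shift by (metis add.assoc add.commute)
  next
    assume "is_period w' r"
    then show "is_period w r" unfolding is_period_def unshift by (metis add.assoc add.commute)
  qed
  have "segment w d r = segment w' 0 r" for r
    by (rule nth_equalityI) (simp_all add: segment_def shift add_ac)
  then have "segment w d (LEAST p. is_period w p) = segment w' 0 (LEAST p. is_period w' p)"
    by (simp add: same)
  then show ?thesis
    unfolding equivalent_words_def periodic_def min_period_def using assms(1) same by blast
qed

section \<open>The GM-sequence\<close>

text \<open>The hypotheses on the start vector, bundled because every GM-move preserves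
  them.\<close>

definition admissible :: "nat \<Rightarrow> nat \<Rightarrow> (nat \<Rightarrow> int) \<Rightarrow> bool" where
  "admissible l n x \<longleftrightarrow> mono_on {1..n} x \<and> (\<exists>i\<in>{1..n}. int l dvd x i) \<and> vec_range n x \<le> int l"

text \<open>
  The index \<open>q\<close>, as a sum over residues of the index modulo \<open>n\<close>: \<open>1 + (- x i) div l\<close> is the
  signed number of entries \<open>\<le> 0\<close> among \<open>x i, x i + l, x i + 2l, \<dots>\<close>
\<close>

definition level :: "nat \<Rightarrow> nat \<Rightarrow> (nat \<Rightarrow> int) \<Rightarrow> int" where
  "level l n x = (\<Sum>i\<in>{1..n}. 1 + (- x i) div int l)"

section \<open>The pivot and the entries around it\<close>

lemma pivot_props:
  assumes "\<exists>i\<in>{1..n}. int l dvd x i"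
  defines "p \<equiv> pivot l n x"
  shows "p \<in> {1..n}" "int l dvd x p" "\<And>k. k \<in> {1..n} \<Longrightarrow> int l dvd x k \<Longrightarrow> x p \<le> x k"
    "\<And>k. k \<in> {1..n} \<Longrightarrow> p < k \<Longrightarrow> x k \<noteq> x p"
proof -
  let ?M = "{i \<in> {1..n}. int l dvd x i}"
  let ?S = "{i \<in> {1..n}. int l dvd x i \<and> (\<forall>k\<in>{1..n}. int l dvd x k \<longrightarrow> x i \<le> x k)}"
  have "finite ?M" "?M \<noteq> {}" using assms(1) by auto
  then have "arg_min_on x ?M \<in> ?M" by (rule arg_min_if_finite(1))
  moreover have "x (arg_min_on x ?M) \<le> x k" if "k \<in> ?M" for k
    using \<open>finite ?M\<close> \<open>?M \<noteq> {}\<close> that by (rule arg_min_least)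
  ultimately have "arg_min_on x ?M \<in> ?S" by blast
  then have "?S \<noteq> {}" by blast
  have fin: "finite ?S" by simp
  have p: "p = Max ?S" by (simp add: p_def pivot_def)
  have "p \<in> ?S" unfolding p using fin \<open>?S \<noteq> {}\<close> by (rule Max_in)
  then show "p \<in> {1..n}" "int l dvd x p" "\<And>k. k \<in> {1..n} \<Longrightarrow> int l dvd x k \<Longrightarrow> x p \<le> x k"
    by blast+
  show "x k \<noteq> x p" if "k \<in> {1..n}" "p < k" for k
  proof
    assume "x k = x p"
    then have "k \<in> ?S" using \<open>p \<in> ?S\<close> that by auto
    then have "k \<le> p" unfolding p using fin by (rule Max_ge[rotated])
    then show False using that by simp
  qed
qed

text \<open>If \<open>x 1\<close> were as small as \<open>x p - l\<close>, the range bound would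
  make it equal to that multiple of \<open>l\<close>, against the minimality of \<open>x p\<close>.
  Strictness beyond \<open>p\<close> comes from taking the largest index.\<close>

lemma admissible_bounds:
  assumes "admissible l n x" and "l > 0"
  defines "p \<equiv> pivot l n x"
  shows "p \<in> {1..n}" "int l dvd x p"
    "\<And>i. i \<in> {1..n} \<Longrightarrow> i \<le> p \<Longrightarrow> x p - int l < x i \<and> x i \<le> x p"
    "\<And>i. i \<in> {1..n} \<Longrightarrow> p < i \<Longrightarrow> x p < x i \<and> x i \<le> x p + int l"
proof -
  have mono: "mono_on {1..n} x" and ex: "\<exists>i\<in>{1..n}. int l dvd x i" and rg: "x n - x 1 \<le> int l"
    using assms(1) by (auto simp: admissible_def vec_range_def)
  note P = pivot_props[OF ex, folded p_def]
  show p: "p \<in> {1..n}" "int l dvd x p" by (rule P)+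
  have le: "x i \<le> x k" if "i \<in> {1..n}" "k \<in> {1..n}" "i \<le> k" for i k
    using mono_onD[OF mono] that by blast
  have ends: "1 \<in> {1..n}" "n \<in> {1..n}" using p by auto
  have "x 1 \<noteq> x p - int l"
  proof
    assume A: "x 1 = x p - int l"
    then have "int l dvd x 1" using p by simp
    then have "x p \<le> x 1" using P(3) ends by blast
    then show False using A \<open>l > 0\<close> by simp
  qed
  moreover have "x p \<le> x n" using le p ends by simp
  ultimately have low: "x p - int l < x 1" using rg by linarith
  show "x p - int l < x i \<and> x i \<le> x p" if "i \<in> {1..n}" "i \<le> p" for i
    using le[of 1 i] le[of i p] low that p by auto
  show "x p < x i \<and> x i \<le> x p + int l" if "i \<in> {1..n}" "p < i" for i
  proof -
    have "x p \<le> x i" "x i \<le> x n" "x 1 \<le> x p" using le that p ends by auto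
    then show ?thesis using P(4)[OF that] rg by linarith
  qed
qed

text \<open>Order survives because entries to the right of the pivot are strictly larger. The range
  can grow only if the pivot is \<open>n\<close>, and then \<open>x p - l < x 1\<close> leaves room
  for one unit.\<close>

lemma admissible_move:
  assumes "admissible l n x" and "l > 0"
  shows "admissible l n (gm_move l n x)"
proof -
  define p where "p = pivot l n x"
  note B = admissible_bounds[OF assms, folded p_def]
  have move: "gm_move l n x k = (if k = p then x k else x k - 1)" for k
    by (simp add: gm_move_def p_def)
  have mono: "mono_on {1..n} x" and rg: "x n - x 1 \<le> int l"
    using assms(1) by (auto simp: admissible_def vec_range_def)
  have "mono_on {1..n} (gm_move l n x)"
  proof (rule mono_onI)
    fix i k assume ik: "i \<in> {1..n}" "k \<in> {1..n}" "i \<le> k"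
    then have "x i \<le> x k" using mono_onD[OF mono] by blast
    then show "gm_move l n x i \<le> gm_move l n x k"
      using B(4)[of k] ik by (auto simp: move)
  qed
  moreover have "\<exists>i\<in>{1..n}. int l dvd gm_move l n x i"
    using B(1,2) by (intro bexI[of _ p]) (simp_all add: move)
  moreover have "gm_move l n x n - gm_move l n x 1 \<le> int l"
    using B(1) B(3)[of 1] rg by (auto simp: move)
  ultimately show ?thesis by (simp add: admissible_def vec_range_def)
qed

text \<open>With \<open>x p = l * a\<close>, the summand of \<open>level\<close> is
  \<open>1 - a\<close> up to \<open>p\<close> and \<open>- a\<close> beyond, so the level is
  \<open>p - n * a\<close>.\<close>

lemma pivot_level:
  assumes "admissible l n x" and "l > 0"
  shows "int n dvd level l n x - int (pivot l n x)"
proof -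
  define p where "p = pivot l n x"
  note B = admissible_bounds[OF assms, folded p_def]
  obtain a where a: "x p = int l * a" using B(2) by (auto elim: dvdE)
  have div: "1 + (- x i) div int l = (if i \<in> {1..p} then 1 else 0) - a" if "i \<in> {1..n}" for i
  proof (cases "i \<le> p")
    case True
    have "(- x i) div int l = - a"
      by (rule int_div_pos_eq[where r = "x p - x i"]) (use B(3)[OF that True] in \<open>auto simp: a\<close>)
    then show ?thesis using True that by simp
  next
    case False
    have "(- x i) div int l = - a - 1"
      by (rule int_div_pos_eq[where r = "x p + int l - x i"])
        (use B(4)[OF that] False in \<open>auto simp: a algebra_simps\<close>)
    then show ?thesis using False by simp
  qed
  have "level l n x = (\<Sum>i\<in>{1..n}. (if i \<in> {1..p} then 1 else 0) - a)"
    unfolding level_def by (intro sum.cong) (simp_all only: div)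
  also have "\<dots> = (\<Sum>i\<in>{1..n} \<inter> {1..p}. 1) - int n * a"
    by (simp only: sum_subtractf sum.inter_restrict finite_atLeastAtMost) simp
  also have "{1..n} \<inter> {1..p} = {1..p}" using B(1) by auto
  finally show ?thesis by (simp add: p_def)
qed

lemma gm_seq_Suc: "gm_seq l n x (Suc j) = gm_move l n (gm_seq l n x j)"
  by (simp add: gm_seq_def)

lemma admissible_seq:
  assumes "admissible l n x" and "l > 0"
  shows "admissible l n (gm_seq l n x j)"
proof (induction j)
  case 0
  show ?case using assms by (simp add: gm_seq_def)
next
  case (Suc j)
  then show ?case using admissible_move assms(2) by (simp add: gm_seq_Suc)
qed

section \<open>The level along the GM-sequence\<close>

lemma level_move_mono: "l > 0 \<Longrightarrow> level l n x \<le> level l n (gm_move l n x)"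
  unfolding level_def gm_move_def by (intro sum_mono add_left_mono zdiv_mono1) auto

lemma level_add: "l > 0 \<Longrightarrow> level l n (\<lambda>i. x i + int l) = level l n x - int n"
proof -
  assume "l > 0"
  have "(- (x i + int l)) div int l = (- x i) div int l - 1" for i
  proof -
    have "- (x i + int l) = - x i + (- 1) * int l" by simp
    then show ?thesis using \<open>l > 0\<close> by (simp only: div_mult_self1)
  qed
  then show ?thesis by (simp add: level_def sum_subtractf sum.distrib)
qed

lemma div_pred_multiple:
  fixes c :: int
  assumes "int l dvd c" and "l > 0"
  shows "(- c - int k - 1) div int l = (- c - int k) div int l - (if l dvd k then 1 else 0)"
proof (cases "l dvd k")
  case True
  then obtain b where "- c - int k = int l * b"
    using assms(1) by (metis dvd_def dvd_diff dvd_minus_iff int_dvd_int_iff)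
  moreover have "(int l * b - 1) div int l = b - 1"
    by (rule int_div_pos_eq[where r = "int l - 1"]) (use assms(2) in \<open>auto simp: algebra_simps\<close>)
  ultimately show ?thesis using True assms(2) by simp
next
  case False
  define r where "r = (- c - int k) mod int l"
  have "\<not> int l dvd - c - int k"
    using False assms(1) by (metis dvd_diff_right_iff dvd_minus_iff int_dvd_int_iff)
  then have "r \<noteq> 0" by (simp add: r_def dvd_eq_mod_eq_0)
  moreover have "0 \<le> r" "r < int l" using assms(2) by (auto simp: r_def)
  ultimately have "(- c - int k - 1) div int l = (- c - int k) div int l"
    by (intro int_div_pos_eq[where r = "r - 1"]) (auto simp: r_def)
  then show ?thesis using False by simp
qed

text \<open>The moving frame: adding the time \<open>k\<close> leaves all entries but the pivotal one at rest.\<close>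

lemma level_frame_step:
  assumes "admissible l n x" and "l > 0"
  shows "level l n (\<lambda>i. gm_move l n x i + int (Suc k)) =
    level l n (\<lambda>i. x i + int k) - (if l dvd k then 1 else 0)"
proof -
  define p where "p = pivot l n x"
  note B = admissible_bounds[OF assms, folded p_def]
  let ?e = "if l dvd k then 1 else 0 :: int"
  \<comment> \<open>A reduced entry is at rest in the frame; the pivotal one rises from
    \<open>x p + k\<close> to \<open>x p + k + 1\<close>, which costs a unit exactly if
    \<open>l dvd k\<close>.\<close>
  have "1 + (- (gm_move l n x i + int (Suc k))) div int l =
      1 + (- (x i + int k)) div int l - (if i = p then ?e else 0)" for i
  proof (cases "i = p")
    case True
    have "- (x p + int (Suc k)) = - x p - int k - 1" "- (x p + int k) = - x p - int k" by simp_all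
    then show ?thesis
      using True div_pred_multiple[OF B(2) assms(2), of k]
      by (simp only: gm_move_def p_def[symmetric] if_True refl)
  next
    case False
    then show ?thesis by (simp add: gm_move_def p_def[symmetric])
  qed
  then have "level l n (\<lambda>i. gm_move l n x i + int (Suc k)) =
      (\<Sum>i\<in>{1..n}. (1 + (- (x i + int k)) div int l) - (if i = p then ?e else 0))"
    unfolding level_def by (rule sum.cong[OF refl])
  also have "\<dots> = level l n (\<lambda>i. x i + int k) - ?e"
    using B(1) by (simp only: level_def sum_subtractf sum.delta finite_atLeastAtMost if_True)
  finally show ?thesis .
qed

text \<open>In the frame started at time \<open>j\<close>, only the first of \<open>l\<close> moves,
  \<open>k = 0\<close>, lowers the level, by one. Leaving the frame removes \<open>l\<close> from
  every entry, which adds \<open>n\<close>.\<close>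

lemma level_period:
  assumes "admissible l n x" and "l > 0"
  shows "level l n (gm_seq l n x (j + l)) = level l n (gm_seq l n x j) + int n - 1"
proof -
  let ?G = "\<lambda>k. level l n (\<lambda>i. gm_seq l n x (j + k) i + int k)"
  have step: "?G (Suc k) = ?G k - (if l dvd k then 1 else 0)" for k
    using level_frame_step[OF admissible_seq[OF assms] assms(2), of "j + k" k] by (simp add: gm_seq_Suc)
  have "k < l \<Longrightarrow> ?G (Suc k) = ?G 0 - 1" for k
  proof (induction k)
    case 0
    show ?case using step[of 0] by simp
  next
    case (Suc k)
    then have "\<not> l dvd Suc k" by (auto dest: dvd_imp_le)
    then show ?case using Suc step[of "Suc k"] by simp
  qed
  from this[of "l - 1"] have "?G l = ?G 0 - 1" using assms(2) by simp
  then show ?thesis using level_add[OF assms(2)] by simp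
qed

lemma drift_level:
  assumes "admissible l n x" and "l > 0"
  shows "drift n l (\<lambda>j. level l n (gm_seq l n x j))"
proof
  show "n > 0" using assms(1) by (auto simp: admissible_def)
  show "mono (\<lambda>j. level l n (gm_seq l n x j))"
    unfolding mono_iff_le_Suc using level_move_mono[OF assms(2)] by (simp add: gm_seq_Suc)
  show "level l n (gm_seq l n x (j + l)) = level l n (gm_seq l n x j) + int n - 1" for j
    using assms by (rule level_period)
qed (rule assms(2))

section \<open>Letters expressed by levels and counted\<close>

lemma gm_word_Stay_iff:
  assumes "admissible l n x" and "l > 0" and "i \<in> {1..n}"
  shows "gm_word l n x i j = Stay \<longleftrightarrow> int n dvd level l n (gm_seq l n x j) - int i"
proof -
  let ?p = "pivot l n (gm_seq l n x j)" and ?q = "level l n (gm_seq l n x j)"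
  note A = admissible_seq[OF assms(1,2), of j]
  have p: "?p \<in> {1..n}" "int n dvd ?q - int ?p"
    by (rule admissible_bounds(1)[OF A assms(2)] pivot_level[OF A assms(2)])+
  have "i = ?p" if "int n dvd ?q - int i"
  proof -
    have "int n dvd (?q - int i) - (?q - int ?p)" using that p(2) by (rule dvd_diff)
    then have "int n dvd int ?p - int i" by simp
    moreover have "\<bar>int ?p - int i\<bar> < \<bar>int n\<bar>" using p(1) assms(3) by auto
    ultimately have "int ?p - int i = 0" using dvd_imp_le_int not_le by blast
    then show ?thesis by simp
  qed
  then have "i = ?p \<longleftrightarrow> int n dvd ?q - int i" using p(2) by blast
  then show ?thesis unfolding gm_word_def by (metis letter.distinct(1))
qed

text \<open>Each r lowers the entry by one and each s keeps it, so claim (1) becomes a count of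
  letters.\<close>

lemma gm_seq_diff:
  "gm_seq l n x j i - gm_seq l n x (j + k) i = int (count_list (segment (gm_word l n x i) j k) Reduce)"
proof (induction k)
  case 0
  show ?case by (simp add: segment_def)
next
  case (Suc k)
  then show ?case by (auto simp: segment_def gm_word_def gm_seq_Suc gm_move_def)
qed

lemma count_letters: "count_list w Stay + count_list w Reduce = length w"
proof (induction w)
  case (Cons c w)
  then show ?case by (cases c) auto
qed simp

theorem theorem1:
  fixes n l :: nat and x0 :: "nat \<Rightarrow> int"
  assumes "n \<ge> 1" and "l \<ge> 2"
    and "mono_on {1..n} x0"
    and "\<exists>i\<in>{1..n}. int l dvd x0 i"
    and "vec_range n x0 \<le> int l"
  shows
    "(\<forall>i\<in>{1..n}. \<forall>j. gm_seq l n x0 j i - gm_seq l n x0 (j + n * l) i = (int n - 1) * int l) \<and>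
     ((\<forall>i\<in>{1..n}. periodic (gm_word l n x0 i)) \<and>
      (\<forall>i\<in>{1..n}. \<forall>i'\<in>{1..n}. equivalent_words (gm_word l n x0 i) (gm_word l n x0 i')) \<and>
      (\<exists>P. length P = n * l \<and> count_list P Stay = l \<and> count_list P Reduce = (n - 1) * l \<and>
         (\<forall>i\<in>{1..n}. is_period (gm_word l n x0 i) (n * l) \<and>
            (\<exists>a. segment (gm_word l n x0 i) a (n * l) = P)))) \<and>
     (\<forall>i\<in>{1..n}. \<forall>a m. a > 0 \<and> maximal_run Reduce (gm_word l n x0 i) a m \<longrightarrow> l dvd m) \<and>
     (\<forall>i\<in>{1..n}. \<forall>a m. maximal_run Stay (gm_word l n x0 i) a m \<longrightarrow> m \<le> l)"
proof -
  have adm: "admissible l n x0" and "l > 0"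
    using assms by (auto simp: admissible_def)
  define q where "q = (\<lambda>j. level l n (gm_seq l n x0 j))"
  define W where "W = gm_word l n x0"
  interpret drift n l q unfolding q_def using adm \<open>l > 0\<close> by (rule drift_level)
  have Stay: "W i j = Stay \<longleftrightarrow> int n dvd q j - int i" if "i \<in> {1..n}" for i j
    using gm_word_Stay_iff[OF adm \<open>l > 0\<close> that] by (simp add: W_def q_def)
  have Reduce: "c = Reduce \<longleftrightarrow> c \<noteq> Stay" for c by (cases c) auto
  have letter_eqI: "c = c'" if "c = Stay \<longleftrightarrow> c' = Stay" for c c' using that by (cases c; cases c') auto
  have period: "is_period (W i) (n * l)" if "i \<in> {1..n}" for i
    unfolding is_period_def
  proof (intro conjI allI letter_eqI)
    show "n * l > 0" using n_pos l_pos by simp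
    show "W i j = Stay \<longleftrightarrow> W i (j + n * l) = Stay" for j by (simp only: Stay[OF that] dvd_periodic)
  qed
  have shift: "\<exists>d. \<forall>j. W i' j = W i (j + d)" if ii: "i \<in> {1..n}" "i' \<in> {1..n}" for i i'
  proof -
    \<comment> \<open>A natural number congruent to \<open>i' - i\<close> modulo \<open>n\<close>;
      adding \<open>n\<close> keeps the subtraction from truncating.\<close>
    define t where "t = n + i' - i"
    have t: "int i + int t = int i' + int n" using ii by (simp add: t_def)
    have "W i' j = W i (j + t * l)" for j
    proof (rule letter_eqI)
      have "int n dvd q j - (int i' + int n) \<longleftrightarrow> int n dvd q j - int i'"
        using dvd_shift[of j n "int i'"] dvd_periodic by simp
      then show "W i' j = Stay \<longleftrightarrow> W i (j + t * l) = Stay"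
        by (simp only: Stay[OF ii(1)] Stay[OF ii(2)] dvd_shift t)
    qed
    then show ?thesis by blast
  qed
  \<comment> \<open>A window starting at \<open>a\<close> is an initial window of the sequence
    shifted by \<open>a\<close>.\<close>
  have count_Stay: "count_list (segment (W i) a (n * l)) Stay = l" if "i \<in> {1..n}" for i a
    using drift.count_initial[OF drift_shift, of a "int i"] by (simp add: count_segment Stay[OF that])
  have count_Reduce: "count_list (segment (W i) a (n * l)) Reduce = (n - 1) * l" if "i \<in> {1..n}" for i a
    using count_letters[of "segment (W i) a (n * l)"] count_Stay[OF that]
    by (simp add: segment_def diff_mult_distrib)
  have "gm_seq l n x0 j i - gm_seq l n x0 (j + n * l) i = (int n - 1) * int l"
    if "i \<in> {1..n}" for i j
    using gm_seq_diff[of l n x0 j i "n * l"] count_Reduce[OF that] n_pos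
    by (simp add: W_def of_nat_diff)
  moreover have "periodic (W i)" if "i \<in> {1..n}" for i
    using period[OF that] by (auto simp: periodic_def)
  moreover have "equivalent_words (W i) (W i')" if "i \<in> {1..n}" "i' \<in> {1..n}" for i i'
    using shift[OF that] equivalent_words_shift[OF period] that by metis
  moreover have "\<exists>P. length P = n * l \<and> count_list P Stay = l \<and> count_list P Reduce = (n - 1) * l \<and>
         (\<forall>i\<in>{1..n}. is_period (W i) (n * l) \<and> (\<exists>a. segment (W i) a (n * l) = P))"
  proof (intro exI conjI ballI)
    \<comment> \<open>The first \<open>n * l\<close> letters of \<open>W 1\<close> serve as the
      common period; every \<open>W i\<close> contains them because \<open>W 1\<close> is a time
      shift of it.\<close>
    let ?P = "segment (W 1) 0 (n * l)"
    have one: "1 \<in> {1..n}" using n_pos by simp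
    show "length ?P = n * l" by (simp add: segment_def)
    show "count_list ?P Stay = l" "count_list ?P Reduce = (n - 1) * l"
      using one by (rule count_Stay count_Reduce)+
    fix i assume i: "i \<in> {1..n}"
    then show "is_period (W i) (n * l)" by (rule period)
    obtain d where "\<And>j. W 1 j = W i (j + d)" using shift[OF i one] by blast
    then have "segment (W i) d (n * l) = ?P"
      by (intro nth_equalityI) (simp_all add: segment_def add_ac)
    \<comment> \<open>The existential witness was left open before \<open>d\<close> was obtained and
      cannot mention it, hence the choice term.\<close>
    then show "segment (W i) (SOME a. segment (W i) a (n * l) = ?P) (n * l) = ?P" by (rule someI)
  qed
  \<comment> \<open>Maximality and \<open>a > 0\<close> put an s at \<open>a - 1\<close>, so the run
    lies between two hits.\<close>
  moreover have "l dvd m" if "i \<in> {1..n}" "a > 0" "maximal_run Reduce (W i) a m" for i a m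
  proof (rule gap_dvd[of "a - 1" "int i"])
    show "int n dvd q (a - 1) - int i" "int n dvd q (Suc (a - 1) + m) - int i" "m > 0"
      "\<And>j. j \<in> {Suc (a - 1)..<Suc (a - 1) + m} \<Longrightarrow> \<not> int n dvd q j - int i"
      using that by (auto simp: maximal_run_def Reduce Stay)
  qed
  moreover have "m \<le> l" if "i \<in> {1..n}" "maximal_run Stay (W i) a m" for i a m
  proof (rule run_le[of a m "int i"])
    show "\<And>j. j \<in> {a..<a + m} \<Longrightarrow> int n dvd q j - int i" "\<not> int n dvd q (a + m) - int i"
      using that by (auto simp: maximal_run_def Stay)
  qed
  ultimately show ?thesis unfolding W_def by blast
qed

end
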